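(* Let $d\ge1$ and let $X$ be the set of all $\mathbb{Z}$-periodic real-analytic functions $\phi:\mathbb{R}\to\mathbb{R}^d$. For any integer $b\ge 2$, the set $$K=\{\phi\in X: p(\phi,b)=0\}$$ is $C^1$ open in $X$ and $C^{\omega}$ dense in $X$.
   Context: For $\phi\in X$ and $\lambda\in(1/b,1)$ let $W^{\phi}_{\lambda,b}(x)=\sum_{n=0}^{\infty}\lambda^n\phi(b^nx)$. For a linear subspace $V$ of $\mathbb{R}^d$ (with $V=\{0\}$ allowed), $\pi_V$ is the orthogonal projection of $\mathbb{R}^d$ onto $V$. Define $q(\phi,\lambda,b)=\max\{\dim V: V\subset\mathbb{R}^d\text{ a linear subspace such that }\pi_V\circ W^{\phi}_{\lambda,b}\text{ is Lipschitz}\}$ and $p(\phi,b)=\min_{\lambda\in(1/b,1)}q(\phi,\lambda,b)$. "$C^1$ open" means open with respect to the norm $\|f\|_1=\|f\|_0+\|f'\|_0$, where $\|\cdot\|_0$ is the supremum norm. "$C^\omega$ dense" means dense with respect to the usual topology on $\mathbb{Z}$-periodic real-analytic functions, i.e. the (locally convex) inductive limit, as $\varepsilon\to0^+$, of the Banach spaces of $1$-periodic functions that extend to bounded holomorphic functions on the strip $\{|\mathrm{Im}\,z|<\varepsilon\}$, with the supremum norm on that strip. *)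

theory Defs
  imports "HOL-Complex_Analysis.Complex_Analysis"
begin

no_notation fps_nth (infixl "$" 75)

section \<open>Periodic real-analytic functions\<close>

definition real_analytic :: "(real \<Rightarrow> real^'d) \<Rightarrow> bool" where
  "real_analytic f \<longleftrightarrow>
     (\<forall>x. \<exists>r>0. \<exists>a. \<forall>y. \<bar>y - x\<bar> < r \<longrightarrow> (\<lambda>n. (y - x) ^ n *\<^sub>R a n) sums f y)"

definition periodic_analytic :: "(real \<Rightarrow> real^'d) set" where
  "periodic_analytic = {f. real_analytic f \<and> (\<forall>x. f (x + 1) = f x)}"

lemma periodic_analytic_lincomb:
  assumes "f \<in> periodic_analytic" "g \<in> periodic_analytic"
  shows "(\<lambda>x. s *\<^sub>R f x + t *\<^sub>R g x) \<in> periodic_analytic"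
proof -
  have "\<exists>r>0. \<exists>a. \<forall>y. \<bar>y - x\<bar> < r \<longrightarrow>
      (\<lambda>n. (y - x) ^ n *\<^sub>R a n) sums (s *\<^sub>R f y + t *\<^sub>R g y)" for x
  proof -
    obtain r a where r: "r > 0"
      and a: "\<And>y. \<bar>y - x\<bar> < r \<Longrightarrow> (\<lambda>n. (y - x) ^ n *\<^sub>R a n) sums f y"
      using assms(1) unfolding periodic_analytic_def real_analytic_def by blast
    obtain r' a' where r': "r' > 0"
      and a': "\<And>y. \<bar>y - x\<bar> < r' \<Longrightarrow> (\<lambda>n. (y - x) ^ n *\<^sub>R a' n) sums g y"
      using assms(2) unfolding periodic_analytic_def real_analytic_def by blast
    have sums: "(\<lambda>n. (y - x) ^ n *\<^sub>R (s *\<^sub>R a n + t *\<^sub>R a' n)) sums (s *\<^sub>R f y + t *\<^sub>R g y)"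
      if "\<bar>y - x\<bar> < min r r'" for y
      using sums_add[OF sums_scaleR_right[OF a, of y s] sums_scaleR_right[OF a', of y t]] that
      by (simp add: scaleR_add_right mult.commute)
    show ?thesis
    proof (intro exI conjI allI impI)
      show "min r r' > 0" using r r' by simp
    qed (fact sums)
  qed
  then show ?thesis
    using assms by (auto simp: periodic_analytic_def real_analytic_def)
qed

section \<open>Weierstrass-type functions\<close>

definition weierstrass :: "(real \<Rightarrow> real^'d) \<Rightarrow> real \<Rightarrow> nat \<Rightarrow> real \<Rightarrow> real^'d" where
  "weierstrass \<phi> lam b x = (\<Sum>n. lam ^ n *\<^sub>R \<phi> (real b ^ n * x))"

definition orth_proj :: "(real^'d) set \<Rightarrow> real^'d \<Rightarrow> real^'d" where
  "orth_proj V x = (THE y. y \<in> V \<and> (\<forall>v\<in>V. orthogonal (x - y) v))"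

lemma orth_proj_unique:
  fixes V :: "(real^'d) set"
  assumes "subspace V"
  shows "\<exists>!y. y \<in> V \<and> (\<forall>v\<in>V. orthogonal (x - y) v)"
proof -
  obtain y z where y: "y \<in> span V" "\<And>w. w \<in> span V \<Longrightarrow> orthogonal z w" "x = y + z"
    using orthogonal_subspace_decomp_exists[of V x] by blast
  have "u = y" if u: "u \<in> V" "\<forall>v\<in>V. orthogonal (x - u) v" for u
  proof -
    have yV: "y \<in> V" using y(1) assms by (simp add: span_eq_iff[THEN iffD2])
    have d: "u - y \<in> V" using subspace_diff[OF assms u(1) yV] .
    have "(x - u) \<bullet> (u - y) = 0" "(x - y) \<bullet> (u - y) = 0"
      using u(2) y(2)[OF span_base[OF d]] y(3) d by (auto simp: orthogonal_def)
    then have "(u - y) \<bullet> (u - y) = 0" by (simp add: inner_diff_left)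
    then show ?thesis by simp
  qed
  moreover have "y \<in> V \<and> (\<forall>v\<in>V. orthogonal (x - y) v)"
    using y assms by (simp add: span_eq_iff[THEN iffD2])
  ultimately show ?thesis by blast
qed

text \<open>The set of dimensions is nonempty and bounded by \<open>CARD('d)\<close>, so \<open>Max\<close> and \<open>Min\<close> below are
  applied to finite sets, nonempty for \<open>b \<ge> 2\<close>.\<close>

definition lipschitz_dims :: "(real \<Rightarrow> real^'d) \<Rightarrow> real \<Rightarrow> nat \<Rightarrow> nat set" where
  "lipschitz_dims \<phi> lam b =
     {dim V | V. subspace V \<and> (\<exists>C. C-lipschitz_on UNIV (orth_proj V \<circ> weierstrass \<phi> lam b))}"

definition q_dim :: "(real \<Rightarrow> real^'d) \<Rightarrow> real \<Rightarrow> nat \<Rightarrow> nat" where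
  "q_dim \<phi> lam b = Max (lipschitz_dims \<phi> lam b)"

definition p_dim :: "(real \<Rightarrow> real^'d) \<Rightarrow> nat \<Rightarrow> nat" where
  "p_dim \<phi> b = Min ((\<lambda>lam. q_dim \<phi> lam b) ` {1 / real b <..< 1})"

lemma lipschitz_dims_finite_nonempty:
  fixes \<phi> :: "real \<Rightarrow> real^'d"
  shows "finite (lipschitz_dims \<phi> lam b)" "0 \<in> lipschitz_dims \<phi> lam b"
    "lipschitz_dims \<phi> lam b \<subseteq> {..CARD('d)}"
proof -
  show sub: "lipschitz_dims \<phi> lam b \<subseteq> {..CARD('d)}"
    using dim_subset_UNIV[where 'a = "real^'d"] by (auto simp: lipschitz_dims_def)
  then show "finite (lipschitz_dims \<phi> lam b)"
    using finite_subset by blast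
  have "orth_proj {0 :: real^'d} x = 0" for x
    by (simp add: orth_proj_def orthogonal_def)
  then have "0-lipschitz_on UNIV (orth_proj {0} \<circ> weierstrass \<phi> lam b)"
    by (auto simp: lipschitz_on_def)
  moreover have "subspace {0 :: real^'d}" "dim {0 :: real^'d} = 0"
    by (simp_all add: subspace_def)
  ultimately show "0 \<in> lipschitz_dims \<phi> lam b"
    unfolding lipschitz_dims_def by (metis (mono_tags, lifting) mem_Collect_eq)
qed

lemma finite_q_dim_image:
  fixes \<phi> :: "real \<Rightarrow> real^'d"
  shows "finite ((\<lambda>lam. q_dim \<phi> lam b) ` S)"
proof -
  have "q_dim \<phi> lam b \<in> {..CARD('d)}" for lam
  proof -
    have "Max (lipschitz_dims \<phi> lam b) \<in> lipschitz_dims \<phi> lam b"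
      using lipschitz_dims_finite_nonempty(1,2)[of \<phi> lam b] by (intro Max_in) auto
    then show ?thesis
      unfolding q_dim_def by (rule subsetD[OF lipschitz_dims_finite_nonempty(3)])
  qed
  then have "(\<lambda>lam. q_dim \<phi> lam b) ` S \<subseteq> {..CARD('d)}"
    by (rule image_subsetI)
  then show ?thesis
    by (rule finite_subset) simp
qed

section \<open>The \<open>C\<^sup>1\<close> topology\<close>

text \<open>Both suprema are over bounded sets when \<open>f\<close> is periodic and continuously differentiable.\<close>

definition C1_norm :: "(real \<Rightarrow> real^'d) \<Rightarrow> real" where
  "C1_norm f = (SUP x. norm (f x)) + (SUP x. norm (vector_derivative f (at x)))"

definition C1_topology :: "(real \<Rightarrow> real^'d) topology" where
  "C1_topology = topology (\<lambda>U. U \<subseteq> periodic_analytic \<and>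
     (\<forall>f\<in>U. \<exists>e>0. \<forall>g\<in>periodic_analytic. C1_norm (\<lambda>x. g x - f x) < e \<longrightarrow> g \<in> U))"

lemma openin_C1_topology:
  fixes U :: "(real \<Rightarrow> real^'d) set"
  shows "openin C1_topology U \<longleftrightarrow> U \<subseteq> periodic_analytic \<and>
     (\<forall>f\<in>U. \<exists>e>0. \<forall>g\<in>periodic_analytic. C1_norm (\<lambda>x. g x - f x) < e \<longrightarrow> g \<in> U)"
proof -
  have "istopology (\<lambda>U :: (real \<Rightarrow> real^'d) set. U \<subseteq> periodic_analytic \<and>
     (\<forall>f\<in>U. \<exists>e>0. \<forall>g\<in>periodic_analytic. C1_norm (\<lambda>x. g x - f x) < e \<longrightarrow> g \<in> U))"
    (is "istopology ?L")
    unfolding istopology_def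
  proof (intro conjI allI impI)
    fix S T assume S: "?L S" and T: "?L T"
    show "S \<inter> T \<subseteq> periodic_analytic" using S by blast
    show "\<forall>f\<in>S \<inter> T. \<exists>e>0. \<forall>g\<in>periodic_analytic. C1_norm (\<lambda>x. g x - f x) < e \<longrightarrow> g \<in> S \<inter> T"
    proof
      fix f assume "f \<in> S \<inter> T"
      then obtain e e' where "e > 0" "e' > 0"
        "\<forall>g\<in>periodic_analytic. C1_norm (\<lambda>x. g x - f x) < e \<longrightarrow> g \<in> S"
        "\<forall>g\<in>periodic_analytic. C1_norm (\<lambda>x. g x - f x) < e' \<longrightarrow> g \<in> T"
        using S T by blast
      then show "\<exists>e>0. \<forall>g\<in>periodic_analytic. C1_norm (\<lambda>x. g x - f x) < e \<longrightarrow> g \<in> S \<inter> T"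
        by (intro exI[of _ "min e e'"]) auto
    qed
  next
    fix \<K> assume K: "\<forall>K\<in>\<K>. ?L K"
    show "\<Union> \<K> \<subseteq> periodic_analytic" using K by blast
    show "\<forall>f\<in>\<Union> \<K>. \<exists>e>0. \<forall>g\<in>periodic_analytic. C1_norm (\<lambda>x. g x - f x) < e \<longrightarrow> g \<in> \<Union> \<K>"
      using K by (meson Union_iff)
  qed
  from topology_inverse'[OF this] show ?thesis
    by (simp only: C1_topology_def)
qed

lemma topspace_C1_topology: "topspace C1_topology = periodic_analytic"
proof
  have "openin C1_topology periodic_analytic"
    unfolding openin_C1_topology using zero_less_one by blast
  then show "periodic_analytic \<subseteq> topspace C1_topology"
    by (rule openin_subset)
  show "topspace C1_topology \<subseteq> periodic_analytic"
    using openin_topspace[of C1_topology] unfolding openin_C1_topology by blast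
qed

section \<open>The inductive limit topology\<close>

definition strip :: "real \<Rightarrow> complex set" where
  "strip \<epsilon> = {z. \<bar>Im z\<bar> < \<epsilon>}"

text \<open>\<open>F\<close> is a bounded holomorphic extension of \<open>f\<close> to the strip; the values are regarded as
  elements of \<open>\<complex>\<^sup>d\<close> with its Hermitian norm. Only the values of \<open>F\<close> on the strip matter, and there
  \<open>F\<close> is determined by \<open>f\<close> (and therefore inherits periodicity).\<close>

definition bounded_holo_ext :: "real \<Rightarrow> (real \<Rightarrow> real^'d) \<Rightarrow> (complex \<Rightarrow> complex^'d) \<Rightarrow> bool" where
  "bounded_holo_ext \<epsilon> f F \<longleftrightarrow>
     (\<forall>i. (\<lambda>z. F z $ i) holomorphic_on strip \<epsilon>) \<and>
     bounded (F ` strip \<epsilon>) \<and>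
     (\<forall>x i. F (of_real x) $ i = of_real (f x $ i))"

lemma bounded_holo_ext_unique:
  assumes "\<epsilon> > 0" "bounded_holo_ext \<epsilon> f F" "bounded_holo_ext \<epsilon> f G" "z \<in> strip \<epsilon>"
  shows "F z = G z"
proof -
  have strip: "strip \<epsilon> = {z. Im z < \<epsilon>} \<inter> {z. Im z > - \<epsilon>}"
    by (auto simp: strip_def)
  have "open (strip \<epsilon>)" "connected (strip \<epsilon>)"
    unfolding strip
    by (auto intro!: open_Int open_halfspace_Im_lt open_halfspace_Im_gt convex_connected convex_Int
        convex_halfspace_Im_lt convex_halfspace_Im_gt)
  have "F z $ i = G z $ i" for i
  proof -
    have "F z $ i - G z $ i = 0"
    proof (rule analytic_continuation[where f = "\<lambda>z. F z $ i - G z $ i" and S = "strip \<epsilon>"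
          and U = "range of_real" and \<xi> = 0])
      show "(\<lambda>z. F z $ i - G z $ i) holomorphic_on strip \<epsilon>"
        using assms by (auto simp: bounded_holo_ext_def intro!: holomorphic_intros)
      show "range of_real \<subseteq> strip \<epsilon>" "0 \<in> strip \<epsilon>"
        using assms(1) by (auto simp: strip_def)
      show "(0::complex) islimpt range of_real"
        unfolding islimpt_approachable
      proof (intro allI impI)
        fix e :: real assume "e > 0"
        then show "\<exists>x'\<in>range of_real. x' \<noteq> (0::complex) \<and> dist x' 0 < e"
          by (intro bexI[of _ "of_real (e / 2)"] rangeI) auto
      qed
      show "F w $ i - G w $ i = 0" if "w \<in> range of_real" for w
        using assms that by (auto simp: bounded_holo_ext_def)
    qed fact+
    then show ?thesis by simp
  qed
  then show ?thesis by (simp add: vec_eq_iff)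
qed

definition strip_space :: "real \<Rightarrow> (real \<Rightarrow> real^'d) set" where
  "strip_space \<epsilon> = {f \<in> periodic_analytic. \<exists>F. bounded_holo_ext \<epsilon> f F}"

definition strip_norm :: "real \<Rightarrow> (real \<Rightarrow> real^'d) \<Rightarrow> real" where
  "strip_norm \<epsilon> f = (SUP z\<in>strip \<epsilon>. norm ((SOME F. bounded_holo_ext \<epsilon> f F) z))"

lemma strip_norm_eq:
  assumes "\<epsilon> > 0" "bounded_holo_ext \<epsilon> f F"
  shows "strip_norm \<epsilon> f = (SUP z\<in>strip \<epsilon>. norm (F z))"
proof -
  have "bounded_holo_ext \<epsilon> f (SOME F. bounded_holo_ext \<epsilon> f F)"
    using someI[where P = "bounded_holo_ext \<epsilon> f", OF assms(2)] .
  from bounded_holo_ext_unique[OF assms(1) this assms(2)] show ?thesis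
    by (simp add: strip_norm_def)
qed

text \<open>The locally convex inductive limit of the spaces \<open>strip_space \<epsilon>\<close>, that is, the finest
  locally convex topology for which all inclusions of these spaces are continuous: a base of neighbourhoods of
  zero consists of the absolutely convex sets that meet every \<open>strip_space \<epsilon>\<close> in a
  neighbourhood of zero. Such sets absorb \<open>periodic_analytic\<close>, the union of the \<open>strip_space \<epsilon>\<close>.\<close>

definition absolutely_convex :: "(real \<Rightarrow> real^'d) set \<Rightarrow> bool" where
  "absolutely_convex N \<longleftrightarrow> (\<forall>f\<in>N. \<forall>g\<in>N. \<forall>s t. \<bar>s\<bar> + \<bar>t\<bar> \<le> 1 \<longrightarrow> (\<lambda>x. s *\<^sub>R f x + t *\<^sub>R g x) \<in> N)"

definition Comega_zero_nhd :: "(real \<Rightarrow> real^'d) set \<Rightarrow> bool" where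
  "Comega_zero_nhd N \<longleftrightarrow> N \<subseteq> periodic_analytic \<and> absolutely_convex N \<and>
     (\<forall>\<epsilon>>0. \<exists>\<delta>>0. {f \<in> strip_space \<epsilon>. strip_norm \<epsilon> f < \<delta>} \<subseteq> N)"

definition Comega_topology :: "(real \<Rightarrow> real^'d) topology" where
  "Comega_topology = topology (\<lambda>U. U \<subseteq> periodic_analytic \<and>
     (\<forall>f\<in>U. \<exists>N. Comega_zero_nhd N \<and> (\<forall>g\<in>N. (\<lambda>x. f x + g x) \<in> U)))"

lemma Comega_zero_nhd_Int:
  assumes "Comega_zero_nhd M" "Comega_zero_nhd N"
  shows "Comega_zero_nhd (M \<inter> N)"
proof -
  have "\<exists>\<delta>>0. {f \<in> strip_space \<epsilon>. strip_norm \<epsilon> f < \<delta>} \<subseteq> M \<inter> N" if pos: "\<epsilon> > 0" for \<epsilon>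
  proof -
    obtain d where "d > 0" "{f \<in> strip_space \<epsilon>. strip_norm \<epsilon> f < d} \<subseteq> M"
      using assms(1) pos unfolding Comega_zero_nhd_def by meson
    moreover obtain e where "e > 0" "{f \<in> strip_space \<epsilon>. strip_norm \<epsilon> f < e} \<subseteq> N"
      using assms(2) pos unfolding Comega_zero_nhd_def by meson
    ultimately show ?thesis by (intro exI[of _ "min d e"]) auto
  qed
  then show ?thesis
    using assms by (auto simp: Comega_zero_nhd_def absolutely_convex_def)
qed

lemma openin_Comega_topology:
  fixes U :: "(real \<Rightarrow> real^'d) set"
  shows "openin Comega_topology U \<longleftrightarrow> U \<subseteq> periodic_analytic \<and>
     (\<forall>f\<in>U. \<exists>N. Comega_zero_nhd N \<and> (\<forall>g\<in>N. (\<lambda>x. f x + g x) \<in> U))"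
proof -
  have "istopology (\<lambda>U :: (real \<Rightarrow> real^'d) set. U \<subseteq> periodic_analytic \<and>
     (\<forall>f\<in>U. \<exists>N. Comega_zero_nhd N \<and> (\<forall>g\<in>N. (\<lambda>x. f x + g x) \<in> U)))" (is "istopology ?L")
    unfolding istopology_def
  proof (intro conjI allI impI)
    fix S T assume S: "?L S" and T: "?L T"
    show "S \<inter> T \<subseteq> periodic_analytic" using S by blast
    show "\<forall>f\<in>S \<inter> T. \<exists>N. Comega_zero_nhd N \<and> (\<forall>g\<in>N. (\<lambda>x. f x + g x) \<in> S \<inter> T)"
    proof
      fix f assume "f \<in> S \<inter> T"
      then obtain M N where "Comega_zero_nhd M" "\<forall>g\<in>M. (\<lambda>x. f x + g x) \<in> S"
        "Comega_zero_nhd N" "\<forall>g\<in>N. (\<lambda>x. f x + g x) \<in> T"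
        using S T by blast
      then show "\<exists>N. Comega_zero_nhd N \<and> (\<forall>g\<in>N. (\<lambda>x. f x + g x) \<in> S \<inter> T)"
        by (intro exI[of _ "M \<inter> N"]) (auto simp: Comega_zero_nhd_Int)
    qed
  next
    fix \<K> assume K: "\<forall>K\<in>\<K>. ?L K"
    show "\<Union> \<K> \<subseteq> periodic_analytic" using K by blast
    show "\<forall>f\<in>\<Union> \<K>. \<exists>N. Comega_zero_nhd N \<and> (\<forall>g\<in>N. (\<lambda>x. f x + g x) \<in> \<Union> \<K>)"
      using K by (meson Union_iff)
  qed
  from topology_inverse'[OF this] show ?thesis
    by (simp only: Comega_topology_def)
qed

lemma topspace_Comega_topology: "topspace Comega_topology = periodic_analytic"
proof
  have "Comega_zero_nhd (periodic_analytic :: (real \<Rightarrow> real^'d) set)"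
    unfolding Comega_zero_nhd_def absolutely_convex_def strip_space_def
    using periodic_analytic_lincomb zero_less_one by blast
  moreover have "(\<lambda>x. f x + g x) \<in> periodic_analytic"
    if "f \<in> periodic_analytic" "g \<in> periodic_analytic" for f g :: "real \<Rightarrow> real^'d"
    using periodic_analytic_lincomb[OF that, of 1 1] by simp
  ultimately have "openin Comega_topology (periodic_analytic :: (real \<Rightarrow> real^'d) set)"
    unfolding openin_Comega_topology by blast
  then show "(periodic_analytic :: (real \<Rightarrow> real^'d) set) \<subseteq> topspace Comega_topology"
    by (rule openin_subset)
  show "topspace Comega_topology \<subseteq> (periodic_analytic :: (real \<Rightarrow> real^'d) set)"
    using openin_topspace[of Comega_topology] unfolding openin_Comega_topology by blast
qed

end

(* Every projection problem reduces to the scalar functions v . W with W = W^phi_lambda,b, which satisfy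
   g(x) = f(x) + lambda g(bx) with f = v . phi. Solving for g at the preimages x/b contracts Lipschitz
   constants by 1/(lambda b) < 1, so a Lipschitz g has a Lipschitz constant bounded by that of f; with the
   compactness of the unit sphere this gives openness, for a fixed lambda. For density, fix any lambda and
   perturb phi by t eta, where all v . W^eta with v <> 0 are not Lipschitz: as for eigenvalues, at most d
   values of t are exceptional. The components of eta are cos(2 pi x) cos(2 pi b x)^k with distinct k: they
   sum to zero over the preimages of a point under x -> bx, which forces a corresponding Lipschitz g
   to be constant. *)
theory Submission
  imports Defs
begin

section \<open>Weierstrass-type functions of bounded functions\<close>

context
  fixes lam B :: real and b :: nat and \<phi> :: "real \<Rightarrow> real^'d"
  assumes lam: "0 < lam" "lam < 1" and B: "\<And>x. norm (\<phi> x) \<le> B"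
begin

lemma weierstrass_summable: "summable (\<lambda>n. lam ^ n *\<^sub>R \<phi> (real b ^ n * x))"
proof (rule summable_comparison_test')
  show "summable (\<lambda>n. lam ^ n * B)"
    using lam by (intro summable_mult2 summable_geometric) auto
  show "norm (lam ^ n *\<^sub>R \<phi> (real b ^ n * x)) \<le> lam ^ n * B" for n
    using lam B by (simp add: mult_left_mono)
qed

lemma weierstrass_functional_eq:
  "weierstrass \<phi> lam b x = \<phi> x + lam *\<^sub>R weierstrass \<phi> lam b (real b * x)"
proof -
  have "weierstrass \<phi> lam b x = \<phi> x + (\<Sum>n. lam ^ Suc n *\<^sub>R \<phi> (real b ^ Suc n * x))"
    using suminf_split_head[OF weierstrass_summable[of x]] by (simp add: weierstrass_def)
  also have "(\<lambda>n. lam ^ Suc n *\<^sub>R \<phi> (real b ^ Suc n * x)) =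
      (\<lambda>n. lam *\<^sub>R (lam ^ n *\<^sub>R \<phi> (real b ^ n * (real b * x))))"
    by (simp add: mult_ac)
  finally show ?thesis
    unfolding weierstrass_def
    using suminf_scaleR_right[OF weierstrass_summable[of "real b * x"], of lam] by simp
qed

lemma norm_weierstrass_le: "norm (weierstrass \<phi> lam b x) \<le> B / (1 - lam)"
proof -
  have "norm (weierstrass \<phi> lam b x) \<le> (\<Sum>n. lam ^ n * B)"
    unfolding weierstrass_def
  proof (rule norm_suminf_le)
    show "summable (\<lambda>n. lam ^ n * B)"
      using lam by (intro summable_mult2 summable_geometric) auto
    show "norm (lam ^ n *\<^sub>R \<phi> (real b ^ n * x)) \<le> lam ^ n * B" for n
      using lam B by (simp add: mult_left_mono)
  qed
  also have "\<dots> = B / (1 - lam)"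
    using lam suminf_mult2[of "\<lambda>n. lam ^ n" B] suminf_geometric[of lam]
    by (simp add: summable_geometric)
  finally show ?thesis .
qed

end

lemma weierstrass_add_scaled:
  fixes \<phi> \<eta> :: "real \<Rightarrow> real^'d"
  assumes "0 < lam" "lam < 1" "\<And>x. norm (\<phi> x) \<le> B" "\<And>x. norm (\<eta> x) \<le> B'"
  shows "weierstrass (\<lambda>x. \<phi> x + t *\<^sub>R \<eta> x) lam b x = weierstrass \<phi> lam b x + t *\<^sub>R weierstrass \<eta> lam b x"
proof -
  note s = weierstrass_summable[OF assms(1,2,3), where b = b and x = x]
    weierstrass_summable[OF assms(1,2,4), where b = b and x = x]
  have "(\<lambda>n. lam ^ n *\<^sub>R \<phi> (real b ^ n * x) + t *\<^sub>R (lam ^ n *\<^sub>R \<eta> (real b ^ n * x))) sums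
      (weierstrass \<phi> lam b x + t *\<^sub>R weierstrass \<eta> lam b x)"
    unfolding weierstrass_def by (intro sums_add sums_scaleR_right summable_sums s)
  then show ?thesis
    unfolding weierstrass_def[of "\<lambda>x. \<phi> x + t *\<^sub>R \<eta> x"]
    by (simp add: sums_unique[symmetric] scaleR_add_right mult.commute)
qed

text \<open>Each frequency \<open>b ^ n\<close> is an integer, so a unit shift of \<open>x\<close>
  moves every term by whole periods.\<close>

lemma weierstrass_periodic:
  fixes \<phi> :: "real \<Rightarrow> real^'d"
  assumes "\<And>x. \<phi> (x + 1) = \<phi> x"
  shows "weierstrass \<phi> lam b (x + 1) = weierstrass \<phi> lam b x"
proof -
  interpret periodic_fun_simple' \<phi>
    by unfold_locales (rule assms)
  have "\<phi> (real b ^ n * (x + 1)) = \<phi> (real b ^ n * x)" for n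
    using plus_of_nat[of "real b ^ n * x" "b ^ n"] by (simp add: distrib_left)
  then show ?thesis
    by (simp add: weierstrass_def)
qed

section \<open>Lipschitz solutions of the functional equation\<close>

text \<open>The map from \<open>L\<close> to \<open>a + r * (L - a)\<close> contracts towards its
  fixed point \<open>a\<close>, so iterating it improves any Lipschitz bound to \<open>a\<close>. It
  is used with \<open>a = M / (lam * real b - 1)\<close> and with \<open>a = 0\<close>.\<close>

lemma lipschitz_bound_iterate:
  fixes g :: "real \<Rightarrow> real"
  assumes "\<And>x y. \<bar>g x - g y\<bar> \<le> L * \<bar>x - y\<bar>"
    and step: "\<And>L x y. (\<And>x y. \<bar>g x - g y\<bar> \<le> L * \<bar>x - y\<bar>) \<Longrightarrow>
      \<bar>g x - g y\<bar> \<le> (a + r * (L - a)) * \<bar>x - y\<bar>"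
    and r: "0 \<le> r" "r < 1"
  shows "\<bar>g x - g y\<bar> \<le> a * \<bar>x - y\<bar>"
proof -
  have iter: "\<bar>g x - g y\<bar> \<le> (a + r ^ n * (L - a)) * \<bar>x - y\<bar>" for n x y
  proof (induction n arbitrary: x y)
    case 0
    show ?case using assms(1) by simp
  next
    case (Suc n)
    show ?case using step[OF Suc.IH] by (simp add: mult.assoc)
  qed
  have "(\<lambda>n. (a + r ^ n * (L - a)) * \<bar>x - y\<bar>) \<longlonglongrightarrow> (a + 0 * (L - a)) * \<bar>x - y\<bar>"
    using r by (intro tendsto_intros LIMSEQ_power_zero) auto
  then show ?thesis
    using iter by (intro LIMSEQ_le_const[of _ "a * \<bar>x - y\<bar>"]) auto
qed

text \<open>The equation at \<open>x / b\<close> gives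
  \<open>lam * g x = g (x / b) - f (x / b)\<close>, which turns a bound \<open>L\<close> into
  \<open>(L + M) / (lam * real b)\<close>. The fixed point of this map does not depend on
  \<open>C\<close>, as the limit argument for openness requires.\<close>

lemma lipschitz_solution_bound:
  fixes f g :: "real \<Rightarrow> real"
  assumes eq: "\<And>x. g x = f x + lam * g (real b * x)"
    and f: "\<And>x y. \<bar>f x - f y\<bar> \<le> M * \<bar>x - y\<bar>"
    and lam: "0 < lam" "1 < lam * real b"
    and "C-lipschitz_on UNIV g"
  shows "\<bar>g x - g y\<bar> \<le> M / (lam * real b - 1) * \<bar>x - y\<bar>"
proof (rule lipschitz_bound_iterate[where r = "1 / (lam * real b)" and L = C])
  show "\<bar>g x - g y\<bar> \<le> C * \<bar>x - y\<bar>" for x y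
    using lipschitz_onD[OF assms(5), of x y] by (simp add: dist_real_def)
  have b: "0 < real b"
    using lam by (cases "b = 0") auto
  fix L x y
  assume L: "\<And>x y. \<bar>g x - g y\<bar> \<le> L * \<bar>x - y\<bar>"
  have "lam * \<bar>g x - g y\<bar> = \<bar>lam * g x - lam * g y\<bar>"
    using lam by (simp add: abs_mult flip: right_diff_distrib)
  also have "\<dots> = \<bar>(g (x / b) - g (y / b)) - (f (x / b) - f (y / b))\<bar>"
    using eq[of "x / b"] eq[of "y / b"] b by simp
  also have "\<dots> \<le> L * \<bar>x / b - y / b\<bar> + M * \<bar>x / b - y / b\<bar>"
    using L[of "x / b" "y / b"] f[of "x / b" "y / b"] by linarith
  also have "\<dots> = (L + M) * \<bar>x - y\<bar> / b"
    using b by (simp add: abs_divide distrib_right add_divide_distrib flip: diff_divide_distrib)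
  finally have "\<bar>g x - g y\<bar> \<le> ((L + M) / (lam * real b)) * \<bar>x - y\<bar>"
    using lam b by (simp add: field_simps)
  also have "(L + M) / (lam * real b) =
      M / (lam * real b - 1) + 1 / (lam * real b) * (L - M / (lam * real b - 1))"
    using lam b by (simp add: divide_simps) (simp add: algebra_simps)
  finally show "\<bar>g x - g y\<bar> \<le>
      (M / (lam * real b - 1) + 1 / (lam * real b) * (L - M / (lam * real b - 1))) * \<bar>x - y\<bar>" .
qed (use lam in auto)

text \<open>Summing over the \<open>b\<close> preimages of \<open>x\<close> multiplies \<open>g\<close> by \<open>lam * b > 1\<close> but does not
  increase its Lipschitz constant, which must therefore vanish.\<close>

lemma lipschitz_solution_constant:
  fixes f g :: "real \<Rightarrow> real"
  assumes eq: "\<And>x. g x = f x + lam * g (real b * x)"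
    and f: "\<And>x. (\<Sum>r<b. f ((x + real r) / real b)) = 0"
    and per: "\<And>x. g (x + 1) = g x"
    and lam: "0 < lam" "1 < lam * real b"
    and "C-lipschitz_on UNIV g"
  shows "g x = g y"
proof -
  interpret periodic_fun_simple' g
    by unfold_locales (rule per)
  have b: "0 < real b"
    using lam by (cases "b = 0") auto
  \<comment> \<open>The points \<open>(x + real r) / b\<close> are the preimages of \<open>x\<close>
    under multiplication by \<open>b\<close> modulo 1.\<close>
  have avg: "(\<Sum>r<b. g ((x + real r) / b)) = lam * real b * g x" for x
  proof -
    have "g ((x + real r) / b) = f ((x + real r) / b) + lam * g x" for r
      using eq[of "(x + real r) / b"] b by (simp add: plus_of_nat)
    then show ?thesis
      using f by (simp add: sum.distrib)
  qed
  have "\<bar>g x - g y\<bar> \<le> 0 * \<bar>x - y\<bar>"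
  proof (rule lipschitz_bound_iterate[where r = "1 / (lam * real b)" and L = C])
    show "\<bar>g x - g y\<bar> \<le> C * \<bar>x - y\<bar>" for x y
      using lipschitz_onD[OF assms(6), of x y] by (simp add: dist_real_def)
    fix L x y
    assume L: "\<And>x y. \<bar>g x - g y\<bar> \<le> L * \<bar>x - y\<bar>"
    have "lam * real b * \<bar>g x - g y\<bar> = \<bar>lam * real b * g x - lam * real b * g y\<bar>"
      using lam b by (simp add: abs_mult flip: right_diff_distrib)
    also have "\<dots> = \<bar>\<Sum>r<b. g ((x + real r) / b) - g ((y + real r) / b)\<bar>"
      by (simp add: avg sum_subtractf)
    also have "\<dots> \<le> (\<Sum>r<b. L * \<bar>x - y\<bar> / b)"
    proof (intro order_trans[OF sum_abs] sum_mono)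
      fix r
      have "\<bar>(x + real r) / b - (y + real r) / b\<bar> = \<bar>x - y\<bar> / b"
        by (simp add: abs_divide flip: diff_divide_distrib)
      then show "\<bar>g ((x + real r) / b) - g ((y + real r) / b)\<bar> \<le> L * \<bar>x - y\<bar> / b"
        using L[of "(x + real r) / b" "(y + real r) / b"] by simp
    qed
    also have "\<dots> = L * \<bar>x - y\<bar>"
      using b by simp
    finally show "\<bar>g x - g y\<bar> \<le> (0 + 1 / (lam * real b) * (L - 0)) * \<bar>x - y\<bar>"
      using lam b by (simp add: field_simps)
  qed (use lam in auto)
  then show ?thesis by simp
qed

section \<open>Exceptional parameters of an affine family\<close>

text \<open>As for eigenvectors of distinct eigenvalues, the vectors \<open>v\<close> belonging to distinct exceptional
  \<open>t\<close> are linearly independent: modulo Lipschitz functions, \<open>v \<bullet> \<Phi> = - t (v \<bullet> H)\<close>, and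
  \<open>w \<mapsto> w \<bullet> H\<close> is injective.\<close>

lemma finite_lipschitz_parameters:
  fixes \<Phi> H :: "real \<Rightarrow> 'a::euclidean_space"
  assumes H: "\<And>w C. C-lipschitz_on UNIV (\<lambda>x. w \<bullet> H x) \<Longrightarrow> w = 0"
  shows "finite {t. \<exists>v C. v \<noteq> 0 \<and> C-lipschitz_on UNIV (\<lambda>x. v \<bullet> (\<Phi> x + t *\<^sub>R H x))}"
    (is "finite ?T")
proof -
  have "\<forall>t\<in>?T. \<exists>v. v \<noteq> 0 \<and> (\<exists>C. C-lipschitz_on UNIV (\<lambda>x. v \<bullet> (\<Phi> x + t *\<^sub>R H x)))"
    by blast
  from bchoice[OF this] obtain v where
    v: "\<forall>t\<in>?T. v t \<noteq> 0 \<and> (\<exists>C. C-lipschitz_on UNIV (\<lambda>x. v t \<bullet> (\<Phi> x + t *\<^sub>R H x)))" ..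
  have nz: "v t \<noteq> 0"
    and lip: "\<exists>C. C-lipschitz_on UNIV (\<lambda>x. v t \<bullet> (\<Phi> x + t *\<^sub>R H x))" if "t \<in> ?T" for t
    using bspec[OF v that] by blast+
  have lip_sum: "\<exists>C. C-lipschitz_on UNIV (\<lambda>x. \<Sum>t\<in>A. c t * (v t \<bullet> (\<Phi> x + t *\<^sub>R H x)))"
    if "finite A" "A \<subseteq> ?T" for A and c :: "real \<Rightarrow> real"
    using that
  proof (induction A rule: finite_induct)
    case empty
    show ?case using lipschitz_on_constant[of UNIV "0::real"] by auto
  next
    case (insert s A)
    then obtain C C' where "C-lipschitz_on UNIV (\<lambda>x. \<Sum>t\<in>A. c t * (v t \<bullet> (\<Phi> x + t *\<^sub>R H x)))"
      "C'-lipschitz_on UNIV (\<lambda>x. v s \<bullet> (\<Phi> x + s *\<^sub>R H x))"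
      using lip[of s] by blast
    from lipschitz_on_add[OF lipschitz_on_cmult_real[OF this(2), of "c s"] this(1)]
    show ?case using insert.hyps by auto
  qed
  \<comment> \<open>In the combination of Lipschitz functions with coefficients \<open>c\<close>,
    the \<open>\<Phi>\<close> part cancels; what remains is a Lipschitz scalar function of
    \<open>H\<close>, whose vector must vanish.\<close>
  have shift: "(\<Sum>t\<in>A. (c t * t) *\<^sub>R v t) = 0"
    if A: "finite A" "A \<subseteq> ?T" and c: "(\<Sum>t\<in>A. c t *\<^sub>R v t) = 0" for A c
  proof -
    have "(\<Sum>t\<in>A. c t * (v t \<bullet> (\<Phi> x + t *\<^sub>R H x))) =
        (\<Sum>t\<in>A. c t *\<^sub>R v t) \<bullet> \<Phi> x + (\<Sum>t\<in>A. (c t * t) *\<^sub>R v t) \<bullet> H x" for x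
      by (simp add: inner_sum_left inner_add_right algebra_simps sum.distrib)
    then show ?thesis
      using lip_sum[OF A, of c] c H by auto
  qed
  have indep: "\<forall>t\<in>A. c t = 0"
    if "finite A" "A \<subseteq> ?T" "(\<Sum>t\<in>A. c t *\<^sub>R v t) = 0" for A c
    using that
  proof (induction A arbitrary: c rule: finite_induct)
    case empty
    show ?case by simp
  next
    case (insert s A)
    \<comment> \<open>Subtracting \<open>s\<close> times the relation from its shifted form removes
      the term of \<open>s\<close> and multiplies every other coefficient by the nonzero
      \<open>t - s\<close>.\<close>
    have "(\<Sum>t\<in>insert s A. (c t * (t - s)) *\<^sub>R v t) =
        (\<Sum>t\<in>insert s A. (c t * t) *\<^sub>R v t) - s *\<^sub>R (\<Sum>t\<in>insert s A. c t *\<^sub>R v t)"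
      unfolding scaleR_sum_right sum_subtractf[symmetric]
      by (intro sum.cong) (simp_all add: algebra_simps)
    also have "\<dots> = 0"
      using shift[of "insert s A" c] insert by simp
    finally have "(\<Sum>t\<in>A. (c t * (t - s)) *\<^sub>R v t) = 0"
      using insert.hyps by simp
    then have A: "\<forall>t\<in>A. c t = 0"
      using insert.IH[of "\<lambda>t. c t * (t - s)"] insert.prems(1) insert.hyps by auto
    then have "c s *\<^sub>R v s = 0"
      using insert.prems(2) insert.hyps by simp
    then show ?case
      using A nz[of s] insert.prems(1) by auto
  qed
  \<comment> \<open>Equal vectors for two parameters would give a relation with coefficients 1 and
    -1. By injectivity there are no more parameters than independent vectors.\<close>
  have inj: "inj_on v ?T"
  proof (rule inj_onI, rule ccontr)
    fix s t assume st: "s \<in> ?T" "t \<in> ?T" "v s = v t" "s \<noteq> t"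
    have "(\<Sum>u\<in>{s, t}. (if u = s then 1 else -1) *\<^sub>R v u) = 0"
      using st by simp
    from indep[OF _ _ this] st show False by auto
  qed
  have "card A \<le> DIM('a)" if A: "finite A" "A \<subseteq> ?T" for A
  proof -
    have injA: "inj_on v A" using inj A by (rule_tac inj_on_subset)
    have "independent (v ` A)"
    proof (rule independent_if_scalars_zero)
      show "finite (v ` A)" using A by simp
      fix f x assume "(\<Sum>x\<in>v ` A. f x *\<^sub>R x) = 0" "x \<in> v ` A"
      then show "f x = 0"
        using indep[OF A, of "f \<circ> v"] by (auto simp: sum.reindex[OF injA])
    qed
    then show ?thesis
      using independent_bound[of "v ` A"] card_image[OF injA] by simp
  qed
  then show ?thesis
    using finite_if_finite_subsets_card_bdd[of ?T "DIM('a)"] by blast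
qed

section \<open>The condition \<open>p = 0\<close>\<close>

lemma orth_proj_in_orthogonal:
  fixes V :: "(real^'d) set"
  assumes "subspace V"
  shows "orth_proj V x \<in> V" "v \<in> V \<Longrightarrow> orthogonal (x - orth_proj V x) v"
  using theI'[OF orth_proj_unique[OF assms, of x]] by (auto simp: orth_proj_def)

text \<open>For \<open>v = 0\<close> the formula relies on division by zero giving 0.\<close>

lemma orth_proj_span_singleton:
  fixes v :: "real^'d"
  shows "orth_proj (span {v}) x = (v \<bullet> x / (v \<bullet> v)) *\<^sub>R v"
proof (cases "v = 0")
  case True
  then show ?thesis by (simp add: orth_proj_def orthogonal_def)
next
  case False
  have "orthogonal (x - (v \<bullet> x / (v \<bullet> v)) *\<^sub>R v) u" if "u \<in> span {v}" for u
    using that False by (auto simp: span_singleton orthogonal_def inner_diff_left inner_diff_right inner_commute)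
  then show ?thesis
    unfolding orth_proj_def
    by (intro the1_equality orth_proj_unique conjI subspace_span ballI) (auto simp: span_singleton)
qed

text \<open>The maximum is 0 only if no nonzero subspace has a Lipschitz projection. A Lipschitz
  scalar function of \<open>v\<close> makes the projection onto the line of \<open>v\<close>
  Lipschitz; conversely, for \<open>v\<close> in \<open>V\<close> the scalar function factors
  through the projection onto \<open>V\<close>.\<close>

lemma q_dim_eq_0_iff:
  fixes \<phi> :: "real \<Rightarrow> real^'d"
  shows "q_dim \<phi> lam b = 0 \<longleftrightarrow>
    (\<forall>v C. C-lipschitz_on UNIV (\<lambda>x. v \<bullet> weierstrass \<phi> lam b x) \<longrightarrow> v = 0)"
proof -
  have "q_dim \<phi> lam b = 0 \<longleftrightarrow> (\<forall>n\<in>lipschitz_dims \<phi> lam b. n = 0)"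
    unfolding q_dim_def
    using lipschitz_dims_finite_nonempty(1,2)[of \<phi> lam b] by (subst Max_eq_iff) auto
  also have "\<dots> \<longleftrightarrow> (\<forall>v C. C-lipschitz_on UNIV (\<lambda>x. v \<bullet> weierstrass \<phi> lam b x) \<longrightarrow> v = 0)"
  proof (intro iffI allI impI ballI)
    fix v C
    assume 0: "\<forall>n\<in>lipschitz_dims \<phi> lam b. n = 0"
      and lip: "C-lipschitz_on UNIV (\<lambda>x. v \<bullet> weierstrass \<phi> lam b x)"
    \<comment> \<open>For nonzero \<open>v\<close> this constant is
      \<open>C / norm v\<close>.\<close>
    have "(norm (inverse (v \<bullet> v) *\<^sub>R v) * C)-lipschitz_on UNIV
        (orth_proj (span {v}) \<circ> weierstrass \<phi> lam b)"
    proof (rule lipschitz_onI)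
      fix x y
      have "orth_proj (span {v}) (weierstrass \<phi> lam b x) - orth_proj (span {v}) (weierstrass \<phi> lam b y) =
          (v \<bullet> weierstrass \<phi> lam b x - v \<bullet> weierstrass \<phi> lam b y) *\<^sub>R (inverse (v \<bullet> v) *\<^sub>R v)"
        by (simp add: orth_proj_span_singleton divide_inverse flip: scaleR_diff_left left_diff_distrib)
      then have "dist ((orth_proj (span {v}) \<circ> weierstrass \<phi> lam b) x)
          ((orth_proj (span {v}) \<circ> weierstrass \<phi> lam b) y) =
          norm (inverse (v \<bullet> v) *\<^sub>R v) *
            dist (v \<bullet> weierstrass \<phi> lam b x) (v \<bullet> weierstrass \<phi> lam b y)"
        unfolding dist_norm comp_apply by (simp only: norm_scaleR real_norm_def mult.commute)
      also have "\<dots> \<le> norm (inverse (v \<bullet> v) *\<^sub>R v) * (C * dist x y)"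
        by (intro mult_left_mono lipschitz_onD[OF lip]) auto
      finally show "dist ((orth_proj (span {v}) \<circ> weierstrass \<phi> lam b) x)
          ((orth_proj (span {v}) \<circ> weierstrass \<phi> lam b) y) \<le>
          norm (inverse (v \<bullet> v) *\<^sub>R v) * C * dist x y"
        by (simp only: mult.assoc)
    next
      show "0 \<le> norm (inverse (v \<bullet> v) *\<^sub>R v) * C"
        using lipschitz_on_nonneg[OF lip] by (intro mult_nonneg_nonneg) auto
    qed
    then have "dim (span {v}) \<in> lipschitz_dims \<phi> lam b"
      unfolding lipschitz_dims_def using subspace_span by blast
    then have "dim (span {v}) = 0" using 0 by blast
    then show "v = 0" by (simp only: dim_span dim_eq_0) auto
  next
    fix n
    assume *: "\<forall>v C. C-lipschitz_on UNIV (\<lambda>x. v \<bullet> weierstrass \<phi> lam b x) \<longrightarrow> v = 0"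
      and "n \<in> lipschitz_dims \<phi> lam b"
    then obtain V C where n: "n = dim V" and V: "subspace V"
      and lip: "C-lipschitz_on UNIV (orth_proj V \<circ> weierstrass \<phi> lam b)"
      by (auto simp: lipschitz_dims_def)
    have "v = 0" if v: "v \<in> V" for v
    proof -
      have proj: "v \<bullet> z = v \<bullet> orth_proj V z" for z
        using orth_proj_in_orthogonal(2)[OF V v, of z]
        by (simp add: orthogonal_def inner_diff_left inner_commute[of v])
      have "(norm v * C)-lipschitz_on UNIV (\<lambda>x. v \<bullet> weierstrass \<phi> lam b x)"
      proof (rule lipschitz_onI)
        fix x y
        have "dist (v \<bullet> weierstrass \<phi> lam b x) (v \<bullet> weierstrass \<phi> lam b y) =
            \<bar>v \<bullet> (orth_proj V (weierstrass \<phi> lam b x) - orth_proj V (weierstrass \<phi> lam b y))\<bar>"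
          by (simp add: proj[of "weierstrass _ _ _ _"] dist_real_def inner_diff_right)
        also have "\<dots> \<le> norm v * norm (orth_proj V (weierstrass \<phi> lam b x) - orth_proj V (weierstrass \<phi> lam b y))"
          by (rule Cauchy_Schwarz_ineq2)
        also have "\<dots> \<le> norm v * (C * dist x y)"
          using lipschitz_onD[OF lip, of x y] by (intro mult_left_mono) (auto simp: dist_norm)
        finally show "dist (v \<bullet> weierstrass \<phi> lam b x) (v \<bullet> weierstrass \<phi> lam b y) \<le> norm v * C * dist x y"
          by (simp only: mult.assoc)
      next
        show "0 \<le> norm v * C"
          using lipschitz_on_nonneg[OF lip] by (intro mult_nonneg_nonneg) auto
      qed
      then show ?thesis using * by blast
    qed
    then show "n = 0" unfolding n by (auto simp: dim_eq_0)
  qed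
  finally show ?thesis .
qed

text \<open>The minimum over a finite nonempty set of values is attained, so a single
  \<open>lam\<close> witnesses that \<open>p\<close> vanishes.\<close>

lemma p_dim_eq_0_iff:
  fixes \<phi> :: "real \<Rightarrow> real^'d"
  assumes "b \<ge> 2"
  shows "p_dim \<phi> b = 0 \<longleftrightarrow> (\<exists>lam\<in>{1 / real b<..<1}.
    \<forall>v C. C-lipschitz_on UNIV (\<lambda>x. v \<bullet> weierstrass \<phi> lam b x) \<longrightarrow> v = 0)"
proof -
  have "{1 / real b<..<1} \<noteq> {}"
    using assms by simp
  then have "p_dim \<phi> b = 0 \<longleftrightarrow> (\<exists>lam\<in>{1 / real b<..<1}. q_dim \<phi> lam b = 0)"
    unfolding p_dim_def
    using finite_q_dim_image[of \<phi> b "{1 / real b<..<1}"] by (subst Min_eq_iff) auto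
  then show ?thesis by (simp add: q_dim_eq_0_iff)
qed

section \<open>Real-analytic functions and the \<open>C\<^sup>1\<close> norm\<close>

text \<open>Termwise differentiation gives the series with coefficients \<open>diffs c\<close>;
  differentiating once more shows that this series is continuous.\<close>

lemma power_series_C1:
  fixes h :: "real \<Rightarrow> real"
  assumes "\<And>y. \<bar>y - x\<bar> < r \<Longrightarrow> (\<lambda>n. (y - x) ^ n * c n) sums h y" and y: "\<bar>y - x\<bar> < r"
  shows "(h has_real_derivative (\<Sum>n. diffs c n * (y - x) ^ n)) (at y)"
    and "isCont (\<lambda>y. \<Sum>n. diffs c n * (y - x) ^ n) y"
proof -
  have summ: "summable (\<lambda>n. c n * z ^ n)" if "norm z < r" for z
    using assms(1)[of "x + z"] that by (auto simp: sums_iff mult.commute)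
  have summ': "summable (\<lambda>n. diffs c n * z ^ n)" if "norm z < r" for z
    using termdiff_converges[OF that summ] by simp
  have "((\<lambda>z. \<Sum>n. diffs c n * z ^ n) has_field_derivative (\<Sum>n. diffs (diffs c) n * (y - x) ^ n)) (at (y - x))"
    by (rule termdiffs_strong'[OF summ']) (use y in auto)
  then have "isCont (\<lambda>z. \<Sum>n. diffs c n * z ^ n) (y - x)"
    by (rule DERIV_isCont)
  then show "isCont (\<lambda>y. \<Sum>n. diffs c n * (y - x) ^ n) y"
    using isCont_o2[where f = "\<lambda>y. y - x" and a = y and g = "\<lambda>z. \<Sum>n. diffs c n * z ^ n"] by simp
  have "((\<lambda>z. \<Sum>n. c n * z ^ n) has_field_derivative (\<Sum>n. diffs c n * (y - x) ^ n)) (at (y - x))"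
    by (rule termdiffs_strong'[OF summ]) (use y in auto)
  then have "((\<lambda>y. \<Sum>n. c n * (y - x) ^ n) has_field_derivative (\<Sum>n. diffs c n * (y - x) ^ n)) (at y)"
    using DERIV_shift[of "\<lambda>z. \<Sum>n. c n * z ^ n" _ y "-x"] by simp
  then show "(h has_real_derivative (\<Sum>n. diffs c n * (y - x) ^ n)) (at y)"
  proof (rule DERIV_cong_ev[THEN iffD1, rotated -1, OF _ refl _ refl])
    \<comment> \<open>The series is known to equal \<open>h\<close> only on the ball around
      \<open>x\<close>, which contains a neighbourhood of \<open>y\<close>.\<close>
    have "\<forall>\<^sub>F u in nhds y. u \<in> ball x r"
      using y by (intro eventually_nhds_in_open) (auto simp: dist_real_def abs_minus_commute)
    then show "\<forall>\<^sub>F u in nhds y. (\<Sum>n. c n * (u - x) ^ n) = h u"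
      by eventually_elim (use assms(1) in \<open>auto simp: sums_iff mult.commute dist_real_def abs_minus_commute\<close>)
  qed
qed

text \<open>Near each point the derivative of a coordinate is the differentiated power series. Its
  continuity later bounds the derivative over a period.\<close>

lemma real_analytic_C1:
  fixes f :: "real \<Rightarrow> real^'d"
  assumes "real_analytic f"
  shows "\<exists>D. (\<forall>x. (f has_vector_derivative D x) (at x)) \<and> continuous_on UNIV D"
proof (intro exI[of _ "\<lambda>x. \<chi> i. deriv (\<lambda>y. f y $ i) x"] conjI allI)
  have C1: "((\<lambda>y. f y $ i) has_real_derivative deriv (\<lambda>y. f y $ i) x) (at x) \<and>
      isCont (deriv (\<lambda>y. f y $ i)) x" for x i
  proof -
    obtain r a where r: "r > 0"
      and a: "\<And>y. \<bar>y - x\<bar> < r \<Longrightarrow> (\<lambda>n. (y - x) ^ n *\<^sub>R a n) sums f y"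
      using assms unfolding real_analytic_def by blast
    define c where "c n = a n $ i" for n
    have "(\<lambda>n. (y - x) ^ n * c n) sums (f y $ i)" if "\<bar>y - x\<bar> < r" for y
      using sums_vec_nth[OF a[OF that], of i] by (simp add: c_def)
    note C1 = power_series_C1[of x r c "\<lambda>y. f y $ i", OF this]
    have deriv: "deriv (\<lambda>y. f y $ i) y = (\<Sum>n. diffs c n * (y - x) ^ n)" if "\<bar>y - x\<bar> < r" for y
      using C1(1)[OF _ that] by (intro DERIV_imp_deriv) auto
    have "\<forall>\<^sub>F u in nhds x. u \<in> ball x r"
      using r by (intro eventually_nhds_in_open) auto
    then have "\<forall>\<^sub>F u in nhds x. (\<Sum>n. diffs c n * (u - x) ^ n) = deriv (\<lambda>y. f y $ i) u"
      by eventually_elim (simp add: deriv dist_real_def abs_minus_commute)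
    from isCont_cong[OF this] have "isCont (deriv (\<lambda>y. f y $ i)) x"
      using C1(2)[of x] r by simp
    then show ?thesis
      using C1(1)[of x] deriv[of x] r by simp
  qed
  show "(f has_vector_derivative (\<chi> i. deriv (\<lambda>y. f y $ i) x)) (at x)" for x
    unfolding has_vector_derivative_def
  proof (subst has_derivative_componentwise_within, intro ballI)
    fix u :: "real^'d" assume "u \<in> Basis"
    then obtain i where "u = axis i 1" by (auto simp: Basis_vec_def)
    then show "((\<lambda>x. f x \<bullet> u) has_derivative (\<lambda>y. (y *\<^sub>R (\<chi> i. deriv (\<lambda>y. f y $ i) x)) \<bullet> u)) (at x)"
      using C1[of i x] by (simp add: inner_axis has_field_derivative_def mult.commute[of _ "deriv _ _"])
  qed
  show "continuous_on UNIV (\<lambda>x. \<chi> i. deriv (\<lambda>y. f y $ i) x)"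
    using C1 by (intro continuous_on_vec_lambda continuous_at_imp_continuous_on) auto
qed

lemma periodic_continuous_bounded:
  fixes f :: "real \<Rightarrow> 'a::real_normed_vector"
  assumes "continuous_on UNIV f" "\<And>x. f (x + 1) = f x"
  shows "bounded (range f)"
proof -
  interpret periodic_fun_simple' f
    by unfold_locales (rule assms)
  have "f x \<in> f ` {0..1}" for x
    using plus_of_int[of "frac x" "\<lfloor>x\<rfloor>"] frac_ge_0[of x] frac_lt_1[of x]
    by (intro image_eqI[of _ _ "frac x"]) (auto simp: frac_def)
  moreover have "compact (f ` {0..1})"
    by (intro compact_continuous_image continuous_on_subset[OF assms(1)]) auto
  ultimately show ?thesis
    by (meson bounded_subset compact_imp_bounded image_subsetI)
qed

text \<open>Periodicity and continuity make both suprema in \<open>C1_norm\<close> genuine upper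
  bounds; the second estimate is then the mean value inequality.\<close>

lemma C1_norm_bounds:
  fixes f :: "real \<Rightarrow> real^'d"
  assumes f: "f \<in> periodic_analytic"
  shows "norm (f x) \<le> C1_norm f" and "norm (f x - f y) \<le> C1_norm f * \<bar>x - y\<bar>"
proof -
  obtain D where D: "\<And>x. (f has_vector_derivative D x) (at x)" and cont: "continuous_on UNIV D"
    using real_analytic_C1 f unfolding periodic_analytic_def by blast
  have per: "f (x + 1) = f x" for x
    using f by (simp add: periodic_analytic_def)
  have D_per: "D (x + 1) = D x" for x
  proof -
    have "((\<lambda>x. x + 1) has_vector_derivative 1) (at x)"
      by (auto intro!: derivative_eq_intros)
    from vector_diff_chain_at[OF this D] show ?thesis
      using vector_derivative_unique_at[OF D] by (simp add: o_def per)
  qed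
  have "continuous_on UNIV f"
    using D by (intro continuous_at_imp_continuous_on ballI has_vector_derivative_continuous)
  then have bdd: "bdd_above (range (\<lambda>x. norm (f x)))"
    using periodic_continuous_bounded[of f] per by (auto simp: bounded_iff bdd_above_def)
  have bddD: "bdd_above (range (\<lambda>x. norm (D x)))"
    using periodic_continuous_bounded[OF cont D_per] by (auto simp: bounded_iff bdd_above_def)
  have C1: "C1_norm f = (SUP x. norm (f x)) + (SUP x. norm (D x))"
    using vector_derivative_at[OF D] by (simp add: C1_norm_def)
  have le: "norm (f x) \<le> (SUP x. norm (f x))" "norm (D x) \<le> (SUP x. norm (D x))" for x
    using bdd bddD by (auto intro: cSUP_upper)
  have pos: "0 \<le> (SUP x. norm (f x))" "0 \<le> (SUP x. norm (D x))"
    using le[of 0] norm_ge_zero order_trans by blast+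
  show "norm (f x) \<le> C1_norm f"
    using le(1)[of x] pos by (simp add: C1)
  have "norm (f x - f y) \<le> C1_norm f * norm (x - y)"
  proof (rule differentiable_bound[of UNIV])
    show "(f has_derivative (\<lambda>h. h *\<^sub>R D z)) (at z)" for z
      using D by (simp add: has_vector_derivative_def)
    show "onorm (\<lambda>h. h *\<^sub>R D z) \<le> C1_norm f" for z
      using le(2)[of z] pos by (intro onorm_le) (auto simp: C1 mult.commute intro!: mult_left_mono)
  qed auto
  then show "norm (f x - f y) \<le> C1_norm f * \<bar>x - y\<bar>"
    by simp
qed

section \<open>Openness\<close>

lemma periodic_analytic_diff:
  assumes "f \<in> periodic_analytic" "g \<in> periodic_analytic"
  shows "(\<lambda>x. f x - g x) \<in> periodic_analytic"
  using periodic_analytic_lincomb[OF assms, of 1 "-1"] by simp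

text \<open>For a unit vector \<open>v\<close>, Cauchy-Schwarz passes the Lipschitz bound
  \<open>M\<close> to \<open>v \<bullet> \<phi>\<close>, so the result is uniform in
  \<open>v\<close>.\<close>

lemma lipschitz_weierstrass_bound:
  fixes \<phi> :: "real \<Rightarrow> real^'d"
  assumes \<phi>: "\<phi> \<in> periodic_analytic" and M: "\<And>x y. norm (\<phi> x - \<phi> y) \<le> M * \<bar>x - y\<bar>"
    and lam: "0 < lam" "lam < 1" "1 < lam * real b" and v: "norm v = 1"
    and lip: "C-lipschitz_on UNIV (\<lambda>x. v \<bullet> weierstrass \<phi> lam b x)"
  shows "\<bar>v \<bullet> weierstrass \<phi> lam b x - v \<bullet> weierstrass \<phi> lam b y\<bar> \<le> M / (lam * real b - 1) * \<bar>x - y\<bar>"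
proof (rule lipschitz_solution_bound[OF _ _ lam(1,3) lip])
  show "v \<bullet> weierstrass \<phi> lam b x = v \<bullet> \<phi> x + lam * (v \<bullet> weierstrass \<phi> lam b (real b * x))" for x
    by (subst weierstrass_functional_eq[OF lam(1,2) C1_norm_bounds(1)[OF \<phi>]])
      (simp add: inner_add_right)
  show "\<bar>v \<bullet> \<phi> x - v \<bullet> \<phi> y\<bar> \<le> M * \<bar>x - y\<bar>" for x y
    using Cauchy_Schwarz_ineq2[of v "\<phi> x - \<phi> y"] M[of x y] v
    by (simp add: inner_diff_right)
qed

lemma norm_weierstrass_diff_le:
  fixes \<phi> \<psi> :: "real \<Rightarrow> real^'d"
  assumes "\<phi> \<in> periodic_analytic" "\<psi> \<in> periodic_analytic" and lam: "0 < lam" "lam < 1"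
  shows "norm (weierstrass \<psi> lam b x - weierstrass \<phi> lam b x) \<le> C1_norm (\<lambda>x. \<psi> x - \<phi> x) / (1 - lam)"
proof -
  have d: "(\<lambda>x. \<psi> x - \<phi> x) \<in> periodic_analytic"
    using assms by (intro periodic_analytic_diff)
  have "weierstrass (\<lambda>x. \<phi> x + 1 *\<^sub>R (\<psi> x - \<phi> x)) lam b x =
      weierstrass \<phi> lam b x + 1 *\<^sub>R weierstrass (\<lambda>x. \<psi> x - \<phi> x) lam b x"
    by (rule weierstrass_add_scaled[OF lam]) (rule C1_norm_bounds(1) assms d)+
  then show ?thesis
    using norm_weierstrass_le[OF lam C1_norm_bounds(1)[OF d], where b = b and x = x] by simp
qed

text \<open>Otherwise some \<open>\<psi> n\<close> tending to \<open>\<phi>\<close> have unit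
  vectors \<open>u n\<close> with Lipschitz scalar functions. Their Lipschitz constants are
  uniformly bounded, so a subsequential limit of the \<open>u n\<close> contradicts the assumption
  on \<open>\<phi>\<close>.\<close>

lemma openin_not_lipschitz:
  fixes b :: nat and \<phi> :: "real \<Rightarrow> real^'d"
  assumes lam: "0 < lam" "lam < 1" "1 < lam * real b" and \<phi>: "\<phi> \<in> periodic_analytic"
    and not_lip: "\<forall>v C. C-lipschitz_on UNIV (\<lambda>x. v \<bullet> weierstrass \<phi> lam b x) \<longrightarrow> v = 0"
  shows "\<exists>e>0. \<forall>\<psi>\<in>periodic_analytic. C1_norm (\<lambda>x. \<psi> x - \<phi> x) < e \<longrightarrow>
    (\<forall>v C. C-lipschitz_on UNIV (\<lambda>x. v \<bullet> weierstrass \<psi> lam b x) \<longrightarrow> v = 0)"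
proof (rule ccontr)
  assume contr: "\<not> ?thesis"
  define e where "e n = inverse (real (Suc n))" for n
  have e: "e n > 0" for n by (simp add: e_def)
  have "\<exists>\<psi> u. \<psi> \<in> periodic_analytic \<and> C1_norm (\<lambda>x. \<psi> x - \<phi> x) < e n \<and> norm u = 1 \<and>
      (\<exists>C. C-lipschitz_on UNIV (\<lambda>x. u \<bullet> weierstrass \<psi> lam b x))" for n
  proof -
    obtain \<psi> v C where \<psi>: "\<psi> \<in> periodic_analytic" "C1_norm (\<lambda>x. \<psi> x - \<phi> x) < e n"
      and v: "C-lipschitz_on UNIV (\<lambda>x. v \<bullet> weierstrass \<psi> lam b x)" "v \<noteq> 0"
      using contr e[of n] by blast
    have "(\<bar>1 / norm v\<bar> * C)-lipschitz_on UNIV (\<lambda>x. (1 / norm v) * (v \<bullet> weierstrass \<psi> lam b x))"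
      using v(1) by (rule lipschitz_on_cmult_real)
    then have "(\<bar>1 / norm v\<bar> * C)-lipschitz_on UNIV (\<lambda>x. (v /\<^sub>R norm v) \<bullet> weierstrass \<psi> lam b x)"
      by (simp add: divide_inverse)
    then show ?thesis
      using \<psi> v(2) by (intro exI[of _ \<psi>] exI[of _ "v /\<^sub>R norm v"]) auto
  qed
  then obtain \<psi> u where \<psi>: "\<And>n. \<psi> n \<in> periodic_analytic"
    and close: "\<And>n. C1_norm (\<lambda>x. \<psi> n x - \<phi> x) < e n"
    and u: "\<And>n. norm (u n) = 1"
    and lip: "\<And>n. \<exists>C. C-lipschitz_on UNIV (\<lambda>x. u n \<bullet> weierstrass (\<psi> n) lam b x)"
    by metis
  \<comment> \<open>As \<open>e n \<le> 1\<close>, every \<open>\<psi> n\<close> has Lipschitz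
    constant at most \<open>C1_norm \<phi> + 1\<close>.\<close>
  define L where "L = (C1_norm \<phi> + 1) / (lam * real b - 1)"
  have bound: "\<bar>u n \<bullet> weierstrass (\<psi> n) lam b x - u n \<bullet> weierstrass (\<psi> n) lam b y\<bar> \<le> L * \<bar>x - y\<bar>" for n x y
  proof -
    obtain C where C: "C-lipschitz_on UNIV (\<lambda>x. u n \<bullet> weierstrass (\<psi> n) lam b x)"
      using lip by blast
    have "e n \<le> 1" by (simp add: e_def field_simps)
    have "norm (\<psi> n x - \<psi> n y) \<le> (C1_norm \<phi> + 1) * \<bar>x - y\<bar>" for x y
    proof -
      have "norm (\<psi> n x - \<psi> n y) \<le> norm (\<phi> x - \<phi> y) + norm ((\<psi> n x - \<phi> x) - (\<psi> n y - \<phi> y))"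
        using norm_triangle_ineq[of "\<phi> x - \<phi> y" "(\<psi> n x - \<phi> x) - (\<psi> n y - \<phi> y)"] by (simp add: algebra_simps)
      also have "\<dots> \<le> C1_norm \<phi> * \<bar>x - y\<bar> + C1_norm (\<lambda>x. \<psi> n x - \<phi> x) * \<bar>x - y\<bar>"
        by (intro add_mono C1_norm_bounds(2)[OF \<phi>] C1_norm_bounds(2)[OF periodic_analytic_diff[OF \<psi> \<phi>]])
      also have "\<dots> \<le> C1_norm \<phi> * \<bar>x - y\<bar> + 1 * \<bar>x - y\<bar>"
        using close[of n] \<open>e n \<le> 1\<close> by (intro add_left_mono mult_right_mono) auto
      finally show ?thesis by (simp add: distrib_right)
    qed
    from lipschitz_weierstrass_bound[OF \<psi> this lam u C] show ?thesis
      by (simp add: L_def)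
  qed
  have conv: "(\<lambda>n. weierstrass (\<psi> n) lam b x) \<longlonglongrightarrow> weierstrass \<phi> lam b x" for x
  proof (rule LIM_zero_cancel, rule Lim_null_comparison)
    show "\<forall>\<^sub>F n in sequentially. norm (weierstrass (\<psi> n) lam b x - weierstrass \<phi> lam b x) \<le> e n / (1 - lam)"
    proof (rule always_eventually, rule allI)
      fix n
      have "C1_norm (\<lambda>x. \<psi> n x - \<phi> x) / (1 - lam) \<le> e n / (1 - lam)"
        using close[of n] lam by (intro divide_right_mono) auto
      then show "norm (weierstrass (\<psi> n) lam b x - weierstrass \<phi> lam b x) \<le> e n / (1 - lam)"
        using norm_weierstrass_diff_le[OF \<phi> \<psi>[of n] lam(1,2), where b = b and x = x] by linarith
    qed
    show "(\<lambda>n. e n / (1 - lam)) \<longlonglongrightarrow> 0"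
      unfolding e_def using tendsto_divide_zero[OF LIMSEQ_inverse_real_of_nat] by blast
  qed
  have "compact (sphere (0::real^'d) 1)" by simp
  moreover have "\<forall>n. u n \<in> sphere 0 1" using u by simp
  ultimately have "\<exists>l\<in>sphere 0 1. \<exists>r. strict_mono r \<and> (u \<circ> r) \<longlonglongrightarrow> l"
    unfolding compact_def by blast
  then obtain v r where v: "norm v = 1" and r: "strict_mono r" and uv: "(u \<circ> r) \<longlonglongrightarrow> v"
    by auto
  have "\<bar>v \<bullet> weierstrass \<phi> lam b x - v \<bullet> weierstrass \<phi> lam b y\<bar> \<le> L * \<bar>x - y\<bar>" for x y
  proof (rule LIMSEQ_le_const2)
    have W: "(\<lambda>n. weierstrass (\<psi> (r n)) lam b x) \<longlonglongrightarrow> weierstrass \<phi> lam b x" for x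
      using LIMSEQ_subseq_LIMSEQ[OF conv r] by (simp add: o_def)
    show "(\<lambda>n. \<bar>u (r n) \<bullet> weierstrass (\<psi> (r n)) lam b x - u (r n) \<bullet> weierstrass (\<psi> (r n)) lam b y\<bar>) \<longlonglongrightarrow>
        \<bar>v \<bullet> weierstrass \<phi> lam b x - v \<bullet> weierstrass \<phi> lam b y\<bar>"
      using uv by (intro tendsto_intros W) (simp_all add: o_def)
  qed (use bound in auto)
  \<comment> \<open>\<open>lipschitz_on\<close> demands a nonnegative constant.\<close>
  moreover have "L \<ge> 0"
  proof -
    have "0 \<le> C1_norm \<phi>"
      using C1_norm_bounds(1)[OF \<phi>] norm_ge_zero order_trans by blast
    then show ?thesis using lam by (simp add: L_def)
  qed
  ultimately have "L-lipschitz_on UNIV (\<lambda>x. v \<bullet> weierstrass \<phi> lam b x)"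
    by (intro lipschitz_onI) (auto simp: dist_real_def)
  then show False using not_lip v by force
qed

section \<open>A function for which no projection is Lipschitz\<close>

text \<open>The powers depend only on \<open>b * x\<close> modulo 1, so they are constant on the
  preimages over which the first factor sums to zero. Exponents are thus free to be chosen distinct,
  for linear independence.\<close>

definition cos_family :: "('d \<Rightarrow> nat) \<Rightarrow> nat \<Rightarrow> real \<Rightarrow> real^'d" where
  "cos_family k b x = (\<chi> i. cos (2 * pi * x) * cos (2 * pi * real b * x) ^ k i)"

definition cos_family_ext :: "('d \<Rightarrow> nat) \<Rightarrow> nat \<Rightarrow> complex \<Rightarrow> complex^'d" where
  "cos_family_ext k b z = (\<chi> i. cos (2 * of_real pi * z) * cos (2 * of_real pi * of_nat b * z) ^ k i)"

text \<open>At real points the values and the powers \<open>(y - x) ^ n\<close> are real, so the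
  real parts of the complex Taylor coefficients serve for \<open>f\<close>.\<close>

lemma real_analytic_holomorphic:
  fixes f :: "real \<Rightarrow> real^'d"
  assumes holo: "\<And>i. (\<lambda>z. F z $ i) holomorphic_on UNIV"
    and F: "\<And>x i. F (of_real x) $ i = complex_of_real (f x $ i)"
  shows "real_analytic f"
  unfolding real_analytic_def
proof
  fix x
  define a :: "nat \<Rightarrow> real^'d" where
    "a n = (\<chi> i. Re ((deriv ^^ n) (\<lambda>z. F z $ i) (of_real x) / fact n))" for n
  have "(\<lambda>n. (y - x) ^ n *\<^sub>R a n) sums f y" for y
    unfolding sums_def
  proof (rule vec_tendstoI)
    fix i
    have Re_scale: "Re (z * of_real c) = c * Re z" for z c by simp
    \<comment> \<open>For an entire function any radius beyond \<open>\<bar>y - x\<bar>\<close> will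
      do.\<close>
    have "(\<lambda>n. (deriv ^^ n) (\<lambda>z. F z $ i) (of_real x) / fact n * (of_real y - of_real x) ^ n) sums (F (of_real y) $ i)"
      by (rule holomorphic_power_series[where r = "\<bar>y - x\<bar> + 1"])
        (auto intro: holomorphic_on_subset[OF holo] simp: dist_real_def abs_minus_commute)
    from sums_Re[OF this] have "(\<lambda>n. Re ((deriv ^^ n) (\<lambda>z. F z $ i) (of_real x) / fact n * of_real ((y - x) ^ n))) sums (f y $ i)"
      by (simp only: F Re_complex_of_real of_real_diff of_real_power)
    then have "(\<lambda>n. (y - x) ^ n * a n $ i) sums (f y $ i)"
      by (simp only: Re_scale a_def vec_lambda_beta)
    then show "(\<lambda>n. (\<Sum>j<n. (y - x) ^ j *\<^sub>R a j) $ i) \<longlonglongrightarrow> f y $ i"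
      by (simp add: sums_def)
  qed
  then show "\<exists>r>0. \<exists>a. \<forall>y. \<bar>y - x\<bar> < r \<longrightarrow> (\<lambda>n. (y - x) ^ n *\<^sub>R a n) sums f y"
    using zero_less_one by blast
qed

section \<open>Analyticity, boundedness and small multiples of the cosine family\<close>

lemma cos_family_ext_holomorphic: "(\<lambda>z. cos_family_ext k b z $ i) holomorphic_on S"
  unfolding cos_family_ext_def by (auto intro!: holomorphic_intros)

lemma cos_family_ext_of_real: "cos_family_ext k b (of_real x) $ i = of_real (cos_family k b x $ i)"
  by (simp add: cos_family_ext_def cos_family_def flip: cos_of_real)

lemma cos_family_periodic_analytic: "cos_family k b \<in> periodic_analytic"
proof -
  have "cos (2 * pi * real b * (x + 1)) = cos (2 * pi * real b * x)" for x
    using cos.plus_of_nat[of "2 * pi * real b * x" b] by (simp add: algebra_simps)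
  moreover have "cos (2 * pi * (x + 1)) = cos (2 * pi * x)" for x
    using cos_periodic[of "2 * pi * x"] by (simp add: algebra_simps)
  ultimately have "cos_family k b (x + 1) = cos_family k b x" for x
    by (simp add: cos_family_def)
  moreover have "real_analytic (cos_family k b)"
    by (rule real_analytic_holomorphic[OF cos_family_ext_holomorphic cos_family_ext_of_real])
  ultimately show ?thesis by (simp add: periodic_analytic_def)
qed

text \<open>The modulus of \<open>cos z\<close> is at most \<open>exp \<bar>Im z\<bar>\<close>, and
  imaginary parts are bounded on a strip.\<close>

lemma cos_family_ext_bounded: "bounded (cos_family_ext k b ` strip 1)"
proof -
  have cos_le: "norm (cos (2 * of_real pi * of_nat n * z)) \<le> exp (2 * pi * n)" if "z \<in> strip 1" for n and z :: complex
  proof -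
    have "norm (cos (2 * of_real pi * of_nat n * z)) \<le> exp \<bar>Im (2 * of_real pi * of_nat n * z)\<bar>"
      using cmod_cos_le_exp[of 1 "2 * of_real pi * of_nat n * z"] by simp
    also have "\<bar>Im (2 * of_real pi * of_nat n * z)\<bar> = 2 * pi * n * \<bar>Im z\<bar>"
      by (simp add: abs_mult)
    also have "\<dots> \<le> 2 * pi * n * 1"
      using that by (intro mult_left_mono) (auto simp: strip_def)
    finally show ?thesis by simp
  qed
  have "norm (cos_family_ext k b z) \<le> (\<Sum>i\<in>UNIV. exp (2 * pi) * exp (2 * pi * b) ^ k i)" if z: "z \<in> strip 1" for z
  proof -
    have "norm (cos_family_ext k b z) \<le> (\<Sum>i\<in>UNIV. norm (cos_family_ext k b z $ i))"
      by (simp add: norm_vec_def L2_set_le_sum)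
    also have "\<dots> \<le> (\<Sum>i\<in>UNIV. exp (2 * pi) * exp (2 * pi * b) ^ k i)"
      using cos_le[OF z, of 1] cos_le[OF z, of b]
      by (intro sum_mono) (auto simp: cos_family_ext_def norm_mult norm_power intro!: mult_mono power_mono)
    finally show ?thesis .
  qed
  then show ?thesis
    unfolding bounded_iff by blast
qed

text \<open>It suffices to test \<open>N\<close> on the single strip of half-width 1, where the
  family has a bounded extension.\<close>

lemma small_multiple_in_nhd:
  assumes N: "Comega_zero_nhd N"
  shows "\<exists>d>0. \<forall>t. 0 < t \<and> t < d \<longrightarrow> (\<lambda>x. t *\<^sub>R cos_family k b x) \<in> N"
proof -
  obtain \<delta> where \<delta>: "\<delta> > 0" "{f \<in> strip_space 1. strip_norm 1 f < \<delta>} \<subseteq> N"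
    using N unfolding Comega_zero_nhd_def by (meson zero_less_one)
  obtain B where B: "B > 0" "\<And>z. z \<in> strip 1 \<Longrightarrow> norm (cos_family_ext k b z) \<le> B"
    using cos_family_ext_bounded[of k b] unfolding bounded_pos by auto
  show ?thesis
  proof (intro exI[of _ "\<delta> / B"] conjI allI impI)
    show "\<delta> / B > 0" using \<delta> B by simp
    fix t assume t: "0 < t \<and> t < \<delta> / B"
    have ext: "bounded_holo_ext 1 (\<lambda>x. t *\<^sub>R cos_family k b x) (\<lambda>z. t *\<^sub>R cos_family_ext k b z)"
      unfolding bounded_holo_ext_def
    proof (intro conjI allI)
      show "(\<lambda>z. (t *\<^sub>R cos_family_ext k b z) $ i) holomorphic_on strip 1" for i
        using holomorphic_on_mult[OF holomorphic_on_const[of "of_real t"] cos_family_ext_holomorphic[of k b i]]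
        by (simp add: scaleR_conv_of_real[where 'a = complex])
      show "bounded ((\<lambda>z. t *\<^sub>R cos_family_ext k b z) ` strip 1)"
        using bounded_scaling[OF cos_family_ext_bounded[of k b], of t] by (simp add: image_image)
      show "(t *\<^sub>R cos_family_ext k b (of_real x)) $ i = of_real ((t *\<^sub>R cos_family k b x) $ i)" for x i
        by (simp add: cos_family_ext_of_real scaleR_conv_of_real[where 'a = complex])
    qed
    have "(SUP z\<in>strip 1. norm (t *\<^sub>R cos_family_ext k b z)) \<le> t * B"
    proof (rule cSUP_least)
      have "0 \<in> strip 1" by (simp add: strip_def)
      then show "strip 1 \<noteq> {}" by blast
      show "norm (t *\<^sub>R cos_family_ext k b z) \<le> t * B" if "z \<in> strip 1" for z
        using B(2)[OF that] t by (simp add: mult_left_mono)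
    qed
    also have "t * B < \<delta>"
      using t B by (simp add: field_simps)
    \<comment> \<open>\<open>strip_norm\<close> chooses some extension; by uniqueness the explicit
      one may be used.\<close>
    finally have "strip_norm 1 (\<lambda>x. t *\<^sub>R cos_family k b x) < \<delta>"
      using strip_norm_eq[OF _ ext] by simp
    moreover have "(\<lambda>x. t *\<^sub>R cos_family k b x) \<in> periodic_analytic"
      using periodic_analytic_lincomb[OF cos_family_periodic_analytic[of k b] cos_family_periodic_analytic[of k b], of t 0]
      by simp
    ultimately show "(\<lambda>x. t *\<^sub>R cos_family k b x) \<in> N"
      using \<delta>(2) ext by (auto simp: strip_space_def)
  qed
qed

section \<open>Vanishing preimage sums and linear independence\<close>

lemma sum_cos_equidistributed:
  assumes "b \<ge> 2"
  shows "(\<Sum>r<b. cos (2 * pi * ((x + real r) / real b))) = 0"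
proof -
  \<comment> \<open>The cosines are real parts of a fixed factor times the powers of this root of
    unity, which is not 1 because its angle lies in the interval from 0 (excluded) to
    \<open>pi\<close>.\<close>
  define \<omega> where "\<omega> = cis (2 * pi / real b)"
  have "2 * pi / real b \<le> pi" using assms by (simp add: field_simps)
  then have "cos (2 * pi / real b) < cos 0"
    using assms by (intro cos_monotone_0_pi) auto
  then have "\<omega> \<noteq> 1" by (auto simp: \<omega>_def complex_eq_iff)
  moreover have "\<omega> ^ b = 1"
    using assms unfolding \<omega>_def Complex.DeMoivre by simp
  ultimately have "(\<Sum>r<b. \<omega> ^ r) = 0"
    by (simp add: geometric_sum)
  moreover have "cis (2 * pi * ((x + real r) / real b)) = cis (2 * pi * x / real b) * \<omega> ^ r" for r
    unfolding \<omega>_def Complex.DeMoivre cis_mult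
    by (rule arg_cong[where f = cis]) (use assms in \<open>simp add: field_simps\<close>)
  ultimately have "(\<Sum>r<b. cis (2 * pi * ((x + real r) / real b))) = 0"
    by (simp only: mult_zero_right flip: sum_distrib_left)
  then have "Re (\<Sum>r<b. cis (2 * pi * ((x + real r) / real b))) = 0"
    by simp
  then show ?thesis
    by (simp only: Re_sum cis.sel)
qed

text \<open>The combination is \<open>cos (2 * pi * x)\<close> times a polynomial in
  \<open>cos (2 * pi * real b * x)\<close> whose coefficients are the entries of \<open>w\<close>.
  Constancy makes this polynomial vanish on an interval.\<close>

lemma cos_family_combination_constant:
  fixes w :: "real^'d"
  assumes b: "b \<ge> 2" and k: "inj k" and const: "\<And>x y. w \<bullet> cos_family k b x = w \<bullet> cos_family k b y"
  shows "w = 0"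
proof -
  define p where "p = (\<Sum>i\<in>UNIV. monom (w $ i) (k i))"
  have poly: "w \<bullet> cos_family k b x = cos (2 * pi * x) * poly p (cos (2 * pi * real b * x))" for x
    by (simp add: inner_vec_def cos_family_def p_def poly_sum poly_monom sum_distrib_left mult_ac)
  \<comment> \<open>The first factor vanishes at \<open>1 / 4\<close>, so the constant is 0.\<close>
  have "w \<bullet> cos_family k b (1 / 4) = 0"
    by (simp add: poly)
  then have zero: "cos (2 * pi * x) * poly p (cos (2 * pi * real b * x)) = 0" for x
    using const[of x "1 / 4"] by (simp add: poly)
  have "poly p t = 0" if t: "0 < t" "t < 1" for t
  proof -
    \<comment> \<open>This makes \<open>2 * pi * real b * x\<close> equal to
      \<open>arccos t\<close>, and by \<open>b \<ge> 2\<close> keeps \<open>2 * pi * x\<close> below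
      \<open>pi / 2\<close>, where the cosine is positive.\<close>
    define x where "x = arccos t / (2 * pi * real b)"
    have arc: "0 < arccos t" "arccos t < pi"
      using arccos_lt_bounded[of t] t by auto
    have "2 * pi * x = arccos t / real b"
      using b by (simp add: x_def)
    moreover have "arccos t / real b \<le> arccos t / 2"
      using arc b by (intro divide_left_mono) auto
    ultimately have "cos (2 * pi * x) > 0"
      using arc b by (intro cos_gt_zero_pi) (auto intro: order.strict_trans2[of _ 0])
    then have "poly p (cos (2 * pi * real b * x)) = 0"
      using zero[of x] by simp
    moreover have "2 * pi * real b * x = arccos t"
      using b by (simp add: x_def)
    ultimately show ?thesis
      using t by (simp add: cos_arccos)
  qed
  then have "{0<..<1} \<subseteq> {t. poly p t = 0}" by auto
  moreover have "infinite {0<..<1::real}" by simp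
  ultimately have "p = 0"
    using poly_roots_finite[of p] finite_subset by blast
  \<comment> \<open>Distinct exponents keep the monomials from merging.\<close>
  moreover have "coeff p (k i) = w $ i" for i
    using k by (simp add: p_def coeff_sum inj_eq)
  ultimately show ?thesis by (simp add: vec_eq_iff)
qed

lemma cos_family_not_lipschitz:
  fixes w :: "real^'d"
  assumes b: "b \<ge> 2" and k: "inj k" and lam: "0 < lam" "lam < 1" "1 < lam * real b"
    and lip: "C-lipschitz_on UNIV (\<lambda>x. w \<bullet> weierstrass (cos_family k b) lam b x)"
  shows "w = 0"
proof -
  let ?g = "\<lambda>x. w \<bullet> weierstrass (cos_family k b) lam b x"
  have eq: "?g x = w \<bullet> cos_family k b x + lam * ?g (real b * x)" for x
    by (subst weierstrass_functional_eq[OF lam(1,2) C1_norm_bounds(1)[OF cos_family_periodic_analytic]])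
      (simp add: inner_add_right)
  have sum0: "(\<Sum>r<b. w \<bullet> cos_family k b ((x + real r) / real b)) = 0" for x
  proof -
    have "w \<bullet> cos_family k b ((x + real r) / real b) =
        (w \<bullet> (\<chi> i. cos (2 * pi * x) ^ k i)) * cos (2 * pi * ((x + real r) / real b))" for r
    proof -
      have "2 * pi * real b * ((x + real r) / real b) = 2 * pi * x + real r * (2 * pi)"
        using b by (simp add: field_simps)
      then have "cos (2 * pi * real b * ((x + real r) / real b)) = cos (2 * pi * x)"
        using cos.plus_of_nat[of "2 * pi * x" r] by simp
      then show ?thesis
        by (simp add: cos_family_def inner_vec_def sum_distrib_right mult_ac)
    qed
    then show ?thesis
      by (simp only: sum_cos_equidistributed[OF b] mult_zero_right flip: sum_distrib_left)
  qed
  have "?g (x + 1) = ?g x" for x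
    using cos_family_periodic_analytic[of k b]
    by (subst weierstrass_periodic) (auto simp: periodic_analytic_def)
  from lipschitz_solution_constant[OF eq sum0 this lam(1,3) lip]
  have const: "?g x = ?g y" for x y .
  \<comment> \<open>For constant \<open>?g\<close> the functional equation reads
    \<open>w \<bullet> cos_family k b x = (1 - lam) * ?g x\<close>.\<close>
  have "w \<bullet> cos_family k b x = w \<bullet> cos_family k b y" for x y
    using eq[of x] eq[of y] unfolding const[of x y] const[of "real b * x" "real b * y"] by linarith
  then show ?thesis
    by (rule cos_family_combination_constant[OF b k])
qed

section \<open>Openness and density of the set where \<open>p\<close> vanishes\<close>

theorem corollary1p2:
  fixes b :: nat and K :: "(real \<Rightarrow> real^'d) set"
  assumes "b \<ge> 2"
  defines "K \<equiv> {\<phi> \<in> periodic_analytic. p_dim \<phi> b = 0}"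
  shows "openin C1_topology K \<and> Comega_topology closure_of K = periodic_analytic"
proof
  have lam_b: "0 < lam" "lam < 1" "1 < lam * real b" if "lam \<in> {1 / real b<..<1}" for lam
  proof -
    show "0 < lam" using that order.strict_trans1[of 0 "1 / real b" lam] by simp
    show "lam < 1" "1 < lam * real b"
      using that assms by (auto simp: field_simps)
  qed
  show "openin C1_topology K"
    unfolding openin_C1_topology
  proof (intro conjI ballI)
    fix \<phi> assume "\<phi> \<in> K"
    then obtain lam where \<phi>: "\<phi> \<in> periodic_analytic" and lam: "lam \<in> {1 / real b<..<1}"
      and "\<forall>v C. C-lipschitz_on UNIV (\<lambda>x. v \<bullet> weierstrass \<phi> lam b x) \<longrightarrow> v = 0"
      unfolding K_def using p_dim_eq_0_iff[OF assms(1)] by blast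
    \<comment> \<open>The same \<open>lam\<close> serves as witness for all nearby
      functions.\<close>
    from openin_not_lipschitz[OF lam_b[OF lam] this(1,3)]
    show "\<exists>e>0. \<forall>g\<in>periodic_analytic. C1_norm (\<lambda>x. g x - \<phi> x) < e \<longrightarrow> g \<in> K"
      unfolding K_def mem_Collect_eq p_dim_eq_0_iff[OF assms(1)] using lam by blast
  qed (auto simp: K_def)
  have "\<phi> \<in> Comega_topology closure_of K" if \<phi>: "\<phi> \<in> periodic_analytic" for \<phi> :: "real \<Rightarrow> real^'d"
    unfolding in_closure_of topspace_Comega_topology
  proof (intro conjI allI impI)
    fix T assume "\<phi> \<in> T \<and> openin Comega_topology T"
    then obtain N where N: "Comega_zero_nhd N" "\<And>g. g \<in> N \<Longrightarrow> (\<lambda>x. \<phi> x + g x) \<in> T"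
      and T: "T \<subseteq> periodic_analytic"
      unfolding openin_Comega_topology by blast
    \<comment> \<open>An injection of the finite index type provides distinct exponents.\<close>
    obtain k :: "'d \<Rightarrow> nat" where k: "inj k"
      using finite_imp_inj_to_nat_seg[OF finite[of "UNIV :: 'd set"]] by blast
    obtain d where d: "d > 0" "\<And>t. 0 < t \<Longrightarrow> t < d \<Longrightarrow> (\<lambda>x. t *\<^sub>R cos_family k b x) \<in> N"
      using small_multiple_in_nhd[OF N(1), of k b] by blast
    have "{1 / real b<..<1} \<noteq> {}" using assms(1) by simp
    then obtain lam where lam: "lam \<in> {1 / real b<..<1}" by blast
    \<comment> \<open>These are the \<open>t\<close> for which the perturbed function has a
      Lipschitz scalar function at this \<open>lam\<close>; being finite in number, they leave room
      below \<open>d\<close>.\<close>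
    let ?bad = "{t. \<exists>v C. v \<noteq> 0 \<and> C-lipschitz_on UNIV
      (\<lambda>x. v \<bullet> (weierstrass \<phi> lam b x + t *\<^sub>R weierstrass (cos_family k b) lam b x))}"
    have "finite ?bad"
      by (rule finite_lipschitz_parameters) (rule cos_family_not_lipschitz[OF assms(1) k lam_b[OF lam]])
    moreover have "infinite {0<..<d}" using d by simp
    ultimately have "\<not> {0<..<d} \<subseteq> ?bad" using finite_subset by blast
    then obtain t where t: "0 < t" "t < d" "t \<notin> ?bad"
      unfolding subset_iff greaterThanLessThan_iff by blast
    let ?\<psi> = "\<lambda>x. \<phi> x + t *\<^sub>R cos_family k b x"
    have "weierstrass ?\<psi> lam b x = weierstrass \<phi> lam b x + t *\<^sub>R weierstrass (cos_family k b) lam b x" for x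
      by (rule weierstrass_add_scaled[OF lam_b(1,2)[OF lam]])
        (rule C1_norm_bounds(1) \<phi> cos_family_periodic_analytic)+
    then have "\<forall>v C. C-lipschitz_on UNIV (\<lambda>x. v \<bullet> weierstrass ?\<psi> lam b x) \<longrightarrow> v = 0"
      using t(3) by auto
    then have "p_dim ?\<psi> b = 0"
      unfolding p_dim_eq_0_iff[OF assms(1)] using lam by blast
    moreover have "?\<psi> \<in> T" using N(2) d(2) t by blast
    ultimately show "\<exists>y. y \<in> K \<and> y \<in> T" using T by (auto simp: K_def)
  qed (rule \<phi>)
  then show "Comega_topology closure_of K = periodic_analytic"
    using closure_of_subset_topspace[of Comega_topology K] by (auto simp: topspace_Comega_topology)
qed

end
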